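(* Let $N\ge2$. For all $a,b\in\mathbb Z$, the operator $\mathcal M_{a,b}$ is an explicit quadratic polynomial of the operators $\mathcal M_n$ with coefficients in $\mathbb C(q,t)$; more precisely $$\mathcal M_{a,b}=\frac{q(q+t^2)\,\nu_{a,b}-t(1+q)\,\nu_{a+1,b-1}+(q+t^2)\,\nu_{b-1,a+1}-qt(1+q)\,\nu_{b-2,a+2}}{(q-1)(q^2-t^2)(1-t^2)},$$ where $\nu_{a,b}=\mathcal M_a\mathcal M_b-q\,\mathcal M_{a+1}\mathcal M_{b-1}$.
   Context: $q,t$ are indeterminates; operators act on symmetric rational functions of $x_1,\dots,x_N$ over $\mathbb C(q,t)$; $\Gamma_i$ is the shift $x_i\mapsto qx_i$ (other variables fixed). For $n,a,b\in\mathbb Z$, $$\mathcal M_n=\sum_{i=1}^Nx_i^n\prod_{j\ne i}\frac{tx_i-x_j}{x_i-x_j}\,\Gamma_i,\qquad \mathcal M_{a,b}=\sum_{1\le i<j\le N}s_{a,b}(x_i,x_j)\prod_{k\ne i,j}\frac{(tx_i-x_k)(tx_j-x_k)}{(x_i-x_k)(x_j-x_k)}\,\Gamma_i\Gamma_j,$$ where $s_{a,b}(x_1,x_2)=\dfrac{x_1^{a+1}x_2^{b}-x_2^{a+1}x_1^{b}}{x_1-x_2}$ is the generalized Schur function. *)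

theory Defs
  imports
    "HOL-Library.Poly_Mapping"
    "HOL-Computational_Algebra.Polynomial"
    "HOL-Computational_Algebra.Fraction_Field"
    "HOL-Combinatorics.Permutations"
begin

text \<open>The field $\mathbb{C}(q,t)$, as the fraction field of $\mathbb{C}[q][t]$.\<close>

type_synonym coeff_field = "complex poly poly fract"

definition qv :: coeff_field where
  "qv = Fract [:[:0, 1:]:] 1"

definition tv :: coeff_field where
  "tv = Fract [:0, 1:] 1"

text \<open>
  Polynomials over $\mathbb{C}(q,t)$ in the variables $x_0, x_1, x_2, \ldots$, and their
  fraction field. A monomial is its finitely supported exponent function. The rational
  functions in $x_1, \ldots, x_N$ are singled out by \<open>ratfun_in\<close> below, so that
  \<open>N\<close> is an ordinary natural number.
\<close>

type_synonym mpoly = "(nat \<Rightarrow>\<^sub>0 nat) \<Rightarrow>\<^sub>0 coeff_field"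
type_synonym ratfun = "mpoly fract"

definition const :: "coeff_field \<Rightarrow> ratfun" where
  "const c = Fract (Poly_Mapping.single 0 c) 1"

definition X :: "nat \<Rightarrow> ratfun" where
  "X i = Fract (Poly_Mapping.single (Poly_Mapping.single i 1) 1) 1"

abbreviation q :: ratfun where "q \<equiv> const qv"
abbreviation t :: ratfun where "t \<equiv> const tv"

definition indets :: "mpoly \<Rightarrow> nat set" where
  "indets p = (\<Union>m\<in>Poly_Mapping.keys p. Poly_Mapping.keys m)"

definition ratfun_in :: "nat \<Rightarrow> ratfun set" where
  "ratfun_in N = {f. \<exists>a b. b \<noteq> 0 \<and> f = Fract a b \<and> indets a \<subseteq> {1..N} \<and> indets b \<subseteq> {1..N}}"

definition monom_eval :: "(nat \<Rightarrow> ratfun) \<Rightarrow> (nat \<Rightarrow>\<^sub>0 nat) \<Rightarrow> ratfun" where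
  "monom_eval \<sigma> m = (\<Prod>i\<in>Poly_Mapping.keys m. \<sigma> i ^ Poly_Mapping.lookup m i)"

definition poly_eval :: "(nat \<Rightarrow> ratfun) \<Rightarrow> mpoly \<Rightarrow> ratfun" where
  "poly_eval \<sigma> p = (\<Sum>m\<in>Poly_Mapping.keys p. const (Poly_Mapping.lookup p m) * monom_eval \<sigma> m)"

lemma const_0 [simp]: "const 0 = 0"
  by (simp add: const_def fract_collapse)

lemma const_1 [simp]: "const 1 = 1"
  by (simp add: const_def fract_collapse)

lemma const_add: "const (c + d) = const c + const d"
  by (simp add: const_def single_add)

lemma const_mult: "const (c * d) = const c * const d"
  by (simp add: const_def mult_single)

lemma const_eq_iff [simp]: "const c = const d \<longleftrightarrow> c = d"
proof
  assume "const c = const d"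
  then have "Poly_Mapping.lookup (Poly_Mapping.single 0 c :: mpoly) 0 =
             Poly_Mapping.lookup (Poly_Mapping.single 0 d :: mpoly) 0"
    by (simp add: const_def eq_fract)
  then show "c = d" by simp
qed simp

lemma monom_eval_superset:
  assumes "finite A" "Poly_Mapping.keys m \<subseteq> A"
  shows "monom_eval \<sigma> m = (\<Prod>i\<in>A. \<sigma> i ^ Poly_Mapping.lookup m i)"
  unfolding monom_eval_def
  by (rule prod.mono_neutral_left) (use assms in \<open>auto simp: in_keys_iff\<close>)

lemma monom_eval_add: "monom_eval \<sigma> (m + n) = monom_eval \<sigma> m * monom_eval \<sigma> n"
proof -
  let ?A = "Poly_Mapping.keys m \<union> Poly_Mapping.keys n"
  have "Poly_Mapping.keys (m + n) \<subseteq> ?A" by (rule Poly_Mapping.keys_add)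
  then show ?thesis
    by (simp add: monom_eval_superset[of ?A] lookup_add power_add prod.distrib)
qed

lemma poly_eval_superset:
  assumes "finite A" "Poly_Mapping.keys p \<subseteq> A"
  shows "poly_eval \<sigma> p = (\<Sum>m\<in>A. const (Poly_Mapping.lookup p m) * monom_eval \<sigma> m)"
  unfolding poly_eval_def
  by (rule sum.mono_neutral_left) (use assms in \<open>auto simp: in_keys_iff\<close>)

lemma poly_eval_0 [simp]: "poly_eval \<sigma> 0 = 0"
  by (simp add: poly_eval_def)

lemma poly_eval_single:
  "poly_eval \<sigma> (Poly_Mapping.single m c) = const c * monom_eval \<sigma> m"
  by (subst poly_eval_superset[of "{m}"]) (auto simp: lookup_single when_def)

lemma poly_eval_1 [simp]: "poly_eval \<sigma> 1 = 1"
proof -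
  have "poly_eval \<sigma> (Poly_Mapping.single 0 1) = 1"
    by (simp only: poly_eval_single) (simp add: monom_eval_def)
  then show ?thesis by simp
qed

lemma poly_eval_add: "poly_eval \<sigma> (p + r) = poly_eval \<sigma> p + poly_eval \<sigma> r"
proof -
  let ?A = "Poly_Mapping.keys p \<union> Poly_Mapping.keys r"
  have "Poly_Mapping.keys (p + r) \<subseteq> ?A" by (rule Poly_Mapping.keys_add)
  then show ?thesis
    by (simp add: poly_eval_superset[of ?A] lookup_add const_add distrib_right sum.distrib)
qed

lemma mpoly_induct:
  fixes p :: mpoly
  assumes "P 0" and "\<And>m c p. P p \<Longrightarrow> P (Poly_Mapping.single m c + p)"
  shows "P p"
proof (induction p rule: Poly_Mapping.update_induct)
  case const
  show ?case by (fact assms(1))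
next
  case (update p m c)
  have "Poly_Mapping.update m c p = Poly_Mapping.single m c + p"
    by (rule poly_mapping_eqI)
       (use update in \<open>auto simp: lookup_update lookup_add lookup_single when_def in_keys_iff\<close>)
  then show ?case using assms(2) update by simp
qed

lemma poly_eval_mult: "poly_eval \<sigma> (p * r) = poly_eval \<sigma> p * poly_eval \<sigma> r"
proof (induction p rule: mpoly_induct)
  case (2 m c p)
  have "poly_eval \<sigma> (Poly_Mapping.single m c * r) =
        poly_eval \<sigma> (Poly_Mapping.single m c) * poly_eval \<sigma> r"
    by (induction r rule: mpoly_induct)
       (simp_all add: distrib_left poly_eval_add poly_eval_single mult_single const_mult
          monom_eval_add mult_ac)
  with 2 show ?case by (simp add: distrib_right poly_eval_add)
qed simp

text \<open>
  Simultaneous substitution $x_i \mapsto \sigma_i$ in a rational function. It makes sense when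
  some representation of \<open>f\<close> has a denominator that does not vanish under \<open>\<sigma>\<close>, and the value
  then does not depend on that representation (\<open>subst_Fract\<close>). For the two substitutions used
  here, every nonzero denominator is admissible (\<open>shift_Fract\<close>, \<open>permute_Fract\<close>).
\<close>

definition subst :: "(nat \<Rightarrow> ratfun) \<Rightarrow> ratfun \<Rightarrow> ratfun" where
  "subst \<sigma> f = (THE g. \<exists>a b. f = Fract a b \<and> poly_eval \<sigma> b \<noteq> 0 \<and>
                            g = poly_eval \<sigma> a / poly_eval \<sigma> b)"

lemma subst_Fract:
  assumes "poly_eval \<sigma> b \<noteq> 0"
  shows "subst \<sigma> (Fract a b) = poly_eval \<sigma> a / poly_eval \<sigma> b"
  unfolding subst_def
proof (rule the_equality)
  fix g
  assume "\<exists>a' b'. Fract a b = Fract a' b' \<and> poly_eval \<sigma> b' \<noteq> 0 \<and>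
                  g = poly_eval \<sigma> a' / poly_eval \<sigma> b'"
  then obtain a' b' where *: "Fract a b = Fract a' b'" "poly_eval \<sigma> b' \<noteq> 0"
    "g = poly_eval \<sigma> a' / poly_eval \<sigma> b'" by blast
  from assms *(2) have "b \<noteq> 0" "b' \<noteq> 0" by auto
  with *(1) have "a * b' = a' * b" by (simp add: eq_fract)
  then have "poly_eval \<sigma> a * poly_eval \<sigma> b' = poly_eval \<sigma> a' * poly_eval \<sigma> b"
    by (metis poly_eval_mult)
  with assms *(2,3) show "g = poly_eval \<sigma> a / poly_eval \<sigma> b"
    by (simp add: frac_eq_eq)
qed (use assms in blast)

lemma X_power: "X i ^ k = Fract (Poly_Mapping.single (Poly_Mapping.single i k) 1) 1"
  by (induction k) (simp_all add: X_def fract_collapse mult_single single_add[symmetric])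

lemma poly_eval_eq_0_iff:
  assumes "inj \<pi>" and c: "\<And>i. c i \<noteq> 0" and \<sigma>: "\<And>i. \<sigma> i = const (c i) * X (\<pi> i)"
  shows "poly_eval \<sigma> p = 0 \<longleftrightarrow> p = 0"
proof
  define C where "C m = (\<Prod>i\<in>Poly_Mapping.keys m. c i ^ Poly_Mapping.lookup m i)"
    for m :: "nat \<Rightarrow>\<^sub>0 nat"
  define R where "R m = (\<Sum>i\<in>Poly_Mapping.keys m. Poly_Mapping.single (\<pi> i) (Poly_Mapping.lookup m i))"
    for m :: "nat \<Rightarrow>\<^sub>0 nat"
  have C: "C m \<noteq> 0" for m using c by (simp add: C_def)
  have lookup_R: "Poly_Mapping.lookup (R m) (\<pi> i) = Poly_Mapping.lookup m i" for m i
  proof -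
    have "Poly_Mapping.lookup (R m) (\<pi> i) =
          (\<Sum>j\<in>Poly_Mapping.keys m. if j = i then Poly_Mapping.lookup m j else 0)"
      unfolding R_def lookup_sum using \<open>inj \<pi>\<close>
      by (intro sum.cong) (auto simp: lookup_single when_def inj_eq)
    also have "\<dots> = Poly_Mapping.lookup m i"
      by (simp add: sum.delta in_keys_iff)
    finally show ?thesis .
  qed
  have inj_R: "R m = R n \<longleftrightarrow> m = n" for m n
    by (metis lookup_R poly_mapping_eqI)
  have const_prod: "const (\<Prod>i\<in>A. h i) = (\<Prod>i\<in>A. const (h i))" for A and h :: "nat \<Rightarrow> coeff_field"
    by (induction A rule: infinite_finite_induct) (simp_all add: const_mult)
  have const_pow: "const (d ^ k) = const d ^ k" for d k
    by (induction k) (simp_all add: const_mult)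
  have prod_single: "(\<Prod>i\<in>A. Fract (Poly_Mapping.single (h i) 1 :: mpoly) 1) =
      Fract (Poly_Mapping.single (\<Sum>i\<in>A. h i) 1) 1" for A :: "nat set" and h
    by (induction A rule: infinite_finite_induct) (simp_all add: fract_collapse mult_single)
  have mon: "monom_eval \<sigma> m = const (C m) * Fract (Poly_Mapping.single (R m) 1) 1" for m
    by (simp add: monom_eval_def \<sigma> power_mult_distrib prod.distrib C_def R_def const_prod
        const_pow X_power prod_single)
  have sum_Fract: "(\<Sum>m\<in>A. Fract (h m :: mpoly) 1) = Fract (\<Sum>m\<in>A. h m) 1"
    for A :: "(nat \<Rightarrow>\<^sub>0 nat) set" and h
    by (induction A rule: infinite_finite_induct) (simp_all add: fract_collapse)
  define p' where "p' = (\<Sum>m\<in>Poly_Mapping.keys p.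
      Poly_Mapping.single (R m) (Poly_Mapping.lookup p m * C m))"
  have eval: "poly_eval \<sigma> p = Fract p' 1"
    unfolding poly_eval_def p'_def
    by (simp add: mon const_def mult_single flip: sum_Fract)
  have lookup_p': "Poly_Mapping.lookup p' (R m) = Poly_Mapping.lookup p m * C m" for m
  proof -
    have "Poly_Mapping.lookup p' (R m) =
          (\<Sum>n\<in>Poly_Mapping.keys p. if n = m then Poly_Mapping.lookup p n * C n else 0)"
      unfolding p'_def lookup_sum
      by (intro sum.cong) (auto simp: lookup_single when_def inj_R)
    also have "\<dots> = Poly_Mapping.lookup p m * C m"
      by (simp add: sum.delta in_keys_iff)
    finally show ?thesis .
  qed
  assume "poly_eval \<sigma> p = 0"
  then have "p' = 0" by (simp add: eval Zero_fract_def eq_fract)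
  then have "Poly_Mapping.lookup p m * C m = 0" for m
    using lookup_p'[of m] by simp
  with C show "p = 0" by (intro poly_mapping_eqI) auto
qed simp

lemma qv_nonzero: "qv \<noteq> 0"
  by (simp add: qv_def Zero_fract_def eq_fract)

lemma poly_eval_X: "poly_eval \<sigma> (Poly_Mapping.single (Poly_Mapping.single i 1) 1) = \<sigma> i"
  by (simp add: poly_eval_single monom_eval_def)

definition shift :: "nat \<Rightarrow> ratfun \<Rightarrow> ratfun" where
  "shift i = subst (X(i := q * X i))"

definition permute :: "(nat \<Rightarrow> nat) \<Rightarrow> ratfun \<Rightarrow> ratfun" where
  "permute \<pi> = subst (\<lambda>i. X (\<pi> i))"

lemma shift_Fract:
  assumes "b \<noteq> 0"
  shows "shift i (Fract a b) = poly_eval (X(i := q * X i)) a / poly_eval (X(i := q * X i)) b"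
proof -
  have "poly_eval (X(i := q * X i)) b \<noteq> 0"
    using assms poly_eval_eq_0_iff[of id "\<lambda>j. if j = i then qv else 1" "X(i := q * X i)" b]
    by (simp add: qv_nonzero)
  then show ?thesis unfolding shift_def by (rule subst_Fract)
qed

lemma permute_Fract:
  assumes "inj \<pi>" "b \<noteq> 0"
  shows "permute \<pi> (Fract a b) =
           poly_eval (\<lambda>i. X (\<pi> i)) a / poly_eval (\<lambda>i. X (\<pi> i)) b"
proof -
  have "poly_eval (\<lambda>i. X (\<pi> i)) b \<noteq> 0"
    using assms poly_eval_eq_0_iff[of \<pi> "\<lambda>_. 1" "\<lambda>i. X (\<pi> i)" b] by simp
  then show ?thesis unfolding permute_def by (rule subst_Fract)
qed

lemma shift_X: "shift i (X j) = (if j = i then q * X i else X j)"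
  using poly_eval_X[of "X(i := q * X i)" j] by (simp add: X_def shift_Fract del: fun_upd_apply) (simp add: X_def)

lemma permute_X: "inj \<pi> \<Longrightarrow> permute \<pi> (X i) = X (\<pi> i)"
  using poly_eval_X[of "\<lambda>i. X (\<pi> i)" i] by (simp add: X_def permute_Fract)

definition sym_ratfun :: "nat \<Rightarrow> ratfun set" where
  "sym_ratfun N = {f \<in> ratfun_in N. \<forall>\<pi>. \<pi> permutes {1..N} \<longrightarrow> permute \<pi> f = f}"

definition gen_schur :: "int \<Rightarrow> int \<Rightarrow> ratfun \<Rightarrow> ratfun \<Rightarrow> ratfun" where
  "gen_schur a b x y =
     (x powi (a + 1) * y powi b - y powi (a + 1) * x powi b) / (x - y)"

definition Mac :: "nat \<Rightarrow> int \<Rightarrow> ratfun \<Rightarrow> ratfun" where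
  "Mac N n f =
     (\<Sum>i\<in>{1..N}. X i powi n *
        (\<Prod>j\<in>{1..N} - {i}. (t * X i - X j) / (X i - X j)) * shift i f)"

definition Mac2 :: "nat \<Rightarrow> int \<Rightarrow> int \<Rightarrow> ratfun \<Rightarrow> ratfun" where
  "Mac2 N a b f =
     (\<Sum>(i, j)\<in>{(i, j). 1 \<le> i \<and> i < j \<and> j \<le> N}. gen_schur a b (X i) (X j) *
        (\<Prod>k\<in>{1..N} - {i, j}.
           ((t * X i - X k) * (t * X j - X k)) / ((X i - X k) * (X j - X k))) *
        shift i (shift j f))"

definition nu :: "nat \<Rightarrow> int \<Rightarrow> int \<Rightarrow> ratfun \<Rightarrow> ratfun" where
  "nu N a b f = Mac N a (Mac N b f) - q * Mac N (a + 1) (Mac N (b - 1) f)"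

end

(*
  In the composition M_a M_b = sum_i sum_j x_i^a A_i Gamma_i (x_j^b A_j) Gamma_i Gamma_j, with
  A_i = prod_{k \<noteq> i} (t x_i - x_k) / (x_i - x_k), the combination nu_{a,b} replaces
  x_i^a Gamma_i(x_j)^b by x_i^a Gamma_i(x_j)^(b-1) (Gamma_i(x_j) - q x_i).  The last factor
  kills the diagonal i = j and, for i \<noteq> j, cancels the only denominator x_j - q x_i that involves
  q.  Off the diagonal the coefficient of Gamma_i Gamma_j is then the factor of M_{a,b} common to
  i and j, times x^a y^(b-1) (t x - y) (t y - q x) / (x - y) at x = x_i, y = x_j.  Since the shifts
  commute, the theorem reduces to an identity for rational functions of two variables.
*)
theory Submission
  imports Defs
begin

section \<open>The shifts as commuting field endomorphisms over the constants\<close>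

lemma poly_eval_fun_upd_eq_0_iff: "poly_eval (X(i := q * X i)) b = 0 \<longleftrightarrow> b = 0"
  using poly_eval_eq_0_iff[of id "\<lambda>j. if j = i then qv else 1" "X(i := q * X i)" b]
  by (simp add: qv_nonzero)

lemma shift_add: "shift i (f + g) = shift i f + shift i g"
  by (cases f; cases g)
     (simp add: shift_Fract poly_eval_add poly_eval_mult poly_eval_fun_upd_eq_0_iff
        add_frac_eq mult.commute[of "poly_eval \<sigma> p" "poly_eval \<sigma> r" for \<sigma> p r] del: fun_upd_apply)

lemma shift_mult: "shift i (f * g) = shift i f * shift i g"
  by (cases f; cases g)
     (simp add: shift_Fract poly_eval_mult poly_eval_fun_upd_eq_0_iff del: fun_upd_apply)

lemma shift_const: "shift i (const c) = const c"
  by (simp add: const_def shift_Fract poly_eval_single monom_eval_def)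

lemma shift_0 [simp]: "shift i 0 = 0"
  using shift_const[of i 0] by simp

lemma shift_1 [simp]: "shift i 1 = 1"
  using shift_const[of i 1] by simp

lemma shift_diff: "shift i (f - g) = shift i f - shift i g"
  using shift_add[of i "f - g" g] by (simp add: algebra_simps)

lemma shift_inverse: "shift i (inverse f) = inverse (shift i f)"
proof (cases "f = 0")
  case False
  then have "shift i f * shift i (inverse f) = 1"
    by (simp flip: shift_mult)
  then show ?thesis
    by (metis inverse_unique)
qed simp

lemma shift_divide: "shift i (f / g) = shift i f / shift i g"
  by (simp add: divide_inverse shift_mult shift_inverse)

lemma shift_power: "shift i (f ^ n) = shift i f ^ n"
  by (induction n) (simp_all add: shift_mult)

lemma shift_power_int: "shift i (f powi n) = shift i f powi n"
  by (simp add: power_int_def shift_power shift_inverse)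

lemma shift_sum: "shift i (sum g A) = (\<Sum>j\<in>A. shift i (g j))"
  by (induction A rule: infinite_finite_induct) (simp_all add: shift_add)

lemma shift_prod: "shift i (prod g A) = (\<Prod>j\<in>A. shift i (g j))"
  by (induction A rule: infinite_finite_induct) (simp_all add: shift_mult)

lemma shift_poly_eval: "shift i (poly_eval \<sigma> p) = poly_eval (\<lambda>k. shift i (\<sigma> k)) p"
  by (simp add: poly_eval_def monom_eval_def shift_sum shift_mult shift_const shift_prod shift_power)

text \<open>By \<open>shift_poly_eval\<close> both composites are substitutions, so agreement on the
  variables suffices; there it holds because shifts fix \<open>q\<close>.\<close>

lemma shift_commute: "shift i (shift j f) = shift j (shift i f)"
proof -
  have *: "(\<lambda>k. shift i ((X(j := q * X j)) k)) = (\<lambda>k. shift j ((X(i := q * X i)) k))"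
    by (auto simp: shift_X shift_mult shift_const)
  show ?thesis
    by (cases f) (simp add: shift_Fract shift_divide shift_poly_eval * del: fun_upd_apply)
qed

section \<open>Nonvanishing of the denominators\<close>

text \<open>The two sides are supported on different monomials, whatever \<open>c\<close> is. The
  choices \<open>c = 1\<close>, \<open>0\<close> and \<open>qv\<close> give distinct variables,
  nonzero variables and a nonzero \<open>X j - q * X i\<close>.\<close>

lemma X_neq_const_mult_X:
  assumes "i \<noteq> j"
  shows "X i \<noteq> const c * X j"
proof
  let ?e = "\<lambda>k. Poly_Mapping.single k 1 :: nat \<Rightarrow>\<^sub>0 nat"
  assume "X i = const c * X j"
  then have "(Poly_Mapping.single (?e i) 1 :: mpoly) = Poly_Mapping.single (?e j) c"
    by (simp add: X_def const_def mult_single eq_fract)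
  then have "Poly_Mapping.lookup (Poly_Mapping.single (?e i) 1 :: mpoly) (?e i) =
      Poly_Mapping.lookup (Poly_Mapping.single (?e j) c) (?e i)"
    by simp
  moreover have "?e i \<noteq> ?e j"
    using assms by (metis lookup_single_eq lookup_single_not_eq zero_neq_one)
  ultimately show False
    by (simp add: lookup_single when_def)
qed

lemma X_eq_iff [simp]: "X i = X j \<longleftrightarrow> i = j"
  using X_neq_const_mult_X[of i j 1] by auto

lemma X_nonzero [simp]: "X i \<noteq> 0"
  using X_neq_const_mult_X[of i "Suc i" 0] by simp

lemma q_neq_1: "q \<noteq> 1"
proof -
  have "qv \<noteq> 1"
    by (simp add: qv_def One_fract_def eq_fract one_pCons)
  then show ?thesis
    by (metis const_1 const_eq_iff)
qed

lemma t_power2_neq_1: "t ^ 2 \<noteq> 1"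
proof -
  have "tv * tv \<noteq> 1"
    by (simp add: tv_def One_fract_def eq_fract one_pCons)
  then show ?thesis
    by (metis const_1 const_eq_iff const_mult power2_eq_square)
qed

lemma q_power2_neq_t_power2: "q ^ 2 \<noteq> t ^ 2"
proof -
  have "qv * qv \<noteq> tv * tv"
    by (simp add: qv_def tv_def eq_fract)
  then show ?thesis
    by (metis const_eq_iff const_mult power2_eq_square)
qed

section \<open>Expansion of \<open>nu\<close> over pairs of variables\<close>

definition pair_prod :: "nat \<Rightarrow> nat \<Rightarrow> nat \<Rightarrow> ratfun" where
  "pair_prod N i j = (\<Prod>k\<in>{1..N} - {i, j}.
     ((t * X i - X k) * (t * X j - X k)) / ((X i - X k) * (X j - X k)))"

text \<open>The quotient \<open>(t * x - y) / (x - y)\<close> is the factor \<open>k = j\<close> of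
  the outer product; \<open>t * y - q * x\<close> is the numerator of the shifted inner factor
  \<open>k = i\<close>. Cancelling its denominator uses up one power of \<open>y\<close>, hence the
  exponent \<open>b - 1\<close>.\<close>

definition nu_kernel :: "int \<Rightarrow> int \<Rightarrow> ratfun \<Rightarrow> ratfun \<Rightarrow> ratfun" where
  "nu_kernel a b x y = x powi a * y powi (b - 1) * ((t * x - y) * (t * y - q * x) / (x - y))"

lemma pair_prod_commute: "pair_prod N i j = pair_prod N j i"
  by (simp add: pair_prod_def insert_commute mult.commute)

text \<open>Leaving \<open>shift i (X j)\<close> unevaluated gives diagonal and off-diagonal terms
  one common shape.\<close>

lemma Mac_Mac:
  "Mac N a (Mac N b f) = (\<Sum>i\<in>{1..N}. \<Sum>j\<in>{1..N}. X i powi a * shift i (X j) powi b *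
     ((\<Prod>k\<in>{1..N} - {i}. (t * X i - X k) / (X i - X k)) *
      shift i (\<Prod>k\<in>{1..N} - {j}. (t * X j - X k) / (X j - X k)) * shift i (shift j f)))"
  unfolding Mac_def
  by (simp only: shift_sum shift_mult shift_power_int sum_distrib_left mult_ac)

lemma nu_summand:
  assumes "i \<in> {1..N}" "j \<in> {1..N}"
  shows "(X i powi a * shift i (X j) powi b - q * (X i powi (a + 1) * shift i (X j) powi (b - 1))) *
     ((\<Prod>k\<in>{1..N} - {i}. (t * X i - X k) / (X i - X k)) *
      shift i (\<Prod>k\<in>{1..N} - {j}. (t * X j - X k) / (X j - X k))) =
     (if i = j then 0 else nu_kernel a b (X i) (X j) * pair_prod N i j)"
proof -
  \<comment> \<open>Splitting off one power for every integer \<open>b\<close> needs a nonzero base: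
    with base \<open>0\<close> it fails at \<open>b = 0\<close>.\<close>
  have "shift i (X j) \<noteq> 0"
    by (simp add: shift_X qv_nonzero const_eq_iff[of qv 0, simplified])
  then have "shift i (X j) powi b = shift i (X j) powi (b - 1) * shift i (X j)"
    by (simp add: power_int_diff)
  then have bracket:
    "X i powi a * shift i (X j) powi b - q * (X i powi (a + 1) * shift i (X j) powi (b - 1)) =
      X i powi a * shift i (X j) powi (b - 1) * (shift i (X j) - q * X i)"
    by (simp add: power_int_add algebra_simps)
  show ?thesis
  proof (cases "i = j")
    case True
    show ?thesis
      unfolding bracket using True by (simp add: shift_X)
  next
    case False
    have 1: "(\<Prod>k\<in>{1..N} - {i}. (t * X i - X k) / (X i - X k)) =
        (t * X i - X j) / (X i - X j) *
          (\<Prod>k\<in>{1..N} - {i, j}. (t * X i - X k) / (X i - X k))"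
      using assms False
      by (subst prod.remove[of _ j]) (auto simp: Diff_insert2[symmetric] insert_commute)
    have "shift i (\<Prod>k\<in>{1..N} - {j}. (t * X j - X k) / (X j - X k)) =
        (\<Prod>k\<in>{1..N} - {j}. (t * X j - shift i (X k)) / (X j - shift i (X k)))"
      using False
      by (simp add: shift_prod shift_divide shift_diff shift_mult shift_const shift_X)
    \<comment> \<open>Only the factor \<open>k = i\<close> is changed by \<open>shift i\<close>, so
      it is isolated.\<close>
    also have "\<dots> = (t * X j - q * X i) / (X j - q * X i) *
        (\<Prod>k\<in>{1..N} - {i, j}. (t * X j - shift i (X k)) / (X j - shift i (X k)))"
      using assms False
      by (subst prod.remove[of _ i]) (auto simp: Diff_insert2[symmetric] insert_commute shift_X)
    also have "(\<Prod>k\<in>{1..N} - {i, j}. (t * X j - shift i (X k)) / (X j - shift i (X k))) =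
        (\<Prod>k\<in>{1..N} - {i, j}. (t * X j - X k) / (X j - X k))"
      by (rule prod.cong) (auto simp: shift_X)
    finally have 2: "shift i (\<Prod>k\<in>{1..N} - {j}. (t * X j - X k) / (X j - X k)) =
        (t * X j - q * X i) / (X j - q * X i) *
          (\<Prod>k\<in>{1..N} - {i, j}. (t * X j - X k) / (X j - X k))" .
    have 3: "pair_prod N i j = (\<Prod>k\<in>{1..N} - {i, j}. (t * X i - X k) / (X i - X k)) *
        (\<Prod>k\<in>{1..N} - {i, j}. (t * X j - X k) / (X j - X k))"
      by (simp add: pair_prod_def flip: prod.distrib)
    have "X j - q * X i \<noteq> 0"
      using X_neq_const_mult_X[of j i qv] False by simp
    moreover have "shift i (X j) = X j"
      using False by (simp add: shift_X)
    ultimately show ?thesis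
      unfolding bracket 1 2 3 nu_kernel_def using False by simp
  qed
qed

lemma sum_off_diagonal:
  fixes g :: "nat \<Rightarrow> nat \<Rightarrow> 'a::comm_monoid_add"
  shows "(\<Sum>i\<in>{1..N}. \<Sum>j\<in>{1..N}. if i = j then 0 else g i j) =
    (\<Sum>(i, j)\<in>{(i, j). 1 \<le> i \<and> i < j \<and> j \<le> N}. g i j + g j i)"
proof -
  let ?U = "{(i, j). 1 \<le> i \<and> i < j \<and> j \<le> N}"
  let ?L = "{(i, j). 1 \<le> j \<and> j < i \<and> i \<le> N}"
  have fin: "finite ?U" "finite ?L"
    by (rule finite_subset[of _ "{1..N} \<times> {1..N}"]; auto)+
  have "(\<Sum>i\<in>{1..N}. \<Sum>j\<in>{1..N}. if i = j then 0 else g i j) =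
      (\<Sum>(i, j)\<in>{1..N} \<times> {1..N}. if i = j then 0 else g i j)"
    by (rule sum.cartesian_product)
  also have "\<dots> = (\<Sum>(i, j)\<in>?U \<union> ?L. g i j)"
    by (rule sum.mono_neutral_cong_right) (auto split: if_splits)
  also have "\<dots> = (\<Sum>(i, j)\<in>?U. g i j) + (\<Sum>(i, j)\<in>?L. g i j)"
    using fin by (rule sum.union_disjoint) auto
  also have "(\<Sum>(i, j)\<in>?L. g i j) = (\<Sum>(i, j)\<in>?U. g j i)"
    by (rule sum.reindex_bij_witness[of _ prod.swap prod.swap]) auto
  finally show ?thesis
    by (simp add: sum.distrib case_prod_unfold)
qed

text \<open>Folding the pairs \<open>(j, i)\<close> onto \<open>(i, j)\<close> symmetrizes only the
  kernel, since \<open>pair_prod\<close> is symmetric and the shifts commute. \<open>Mac2\<close>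
  has the same shape, so comparing coefficients pair by pair is enough.\<close>

lemma nu_eq_sum_pairs:
  "nu N a b f = (\<Sum>(i, j)\<in>{(i, j). 1 \<le> i \<and> i < j \<and> j \<le> N}.
     (nu_kernel a b (X i) (X j) + nu_kernel a b (X j) (X i)) *
       (pair_prod N i j * shift i (shift j f)))"
proof -
  let ?g = "\<lambda>i j. nu_kernel a b (X i) (X j) * (pair_prod N i j * shift i (shift j f))"
  let ?A = "\<lambda>i. \<Prod>k\<in>{1..N} - {i}. (t * X i - X k) / (X i - X k)"
  have "nu N a b f = (\<Sum>i\<in>{1..N}. \<Sum>j\<in>{1..N}.
      (X i powi a * shift i (X j) powi b - q * (X i powi (a + 1) * shift i (X j) powi (b - 1))) *
        (?A i * shift i (?A j)) * shift i (shift j f))"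
    unfolding nu_def Mac_Mac
    by (simp only: sum_distrib_left sum_subtractf[symmetric] left_diff_distrib mult.assoc)
  also have "\<dots> = (\<Sum>i\<in>{1..N}. \<Sum>j\<in>{1..N}. if i = j then 0 else ?g i j)"
    by (intro sum.cong refl) (simp only: nu_summand if_distribR mult_zero_left mult.assoc split: if_split, simp)
  also have "\<dots> = (\<Sum>(i, j)\<in>{(i, j). 1 \<le> i \<and> i < j \<and> j \<le> N}. ?g i j + ?g j i)"
    by (rule sum_off_diagonal)
  also have "\<dots> = (\<Sum>(i, j)\<in>{(i, j). 1 \<le> i \<and> i < j \<and> j \<le> N}.
     (nu_kernel a b (X i) (X j) + nu_kernel a b (X j) (X i)) *
       (pair_prod N i j * shift i (shift j f)))"
    by (simp add: distrib_right pair_prod_commute[of N] shift_commute[of _ _ f] case_prod_unfold)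
  finally show ?thesis .
qed

section \<open>The identity in two variables\<close>

lemma kernel_identity:
  fixes c d u v x y :: "'a::comm_ring_1"
  shows "c * (c + d ^ 2) * (u * v * y * ((d * x - y) * (d * y - c * x)))
      - d * (1 + c) * (u * v * x * ((d * x - y) * (d * y - c * x)))
      - (c + d ^ 2) * (u * v * y * ((d * y - x) * (d * x - c * y)))
      + c * d * (1 + c) * (u * v * x * ((d * y - x) * (d * x - c * y)))
    = (c - 1) * (c ^ 2 - d ^ 2) * (1 - d ^ 2) * (u * x * (v * y ^ 2))"
  by (simp add: algebra_simps power2_eq_square)

text \<open>The last two kernels are taken at \<open>(y, x)\<close> because their indices are
  swapped: all four terms are then \<open>x powi a * y powi (b - 2)\<close> times a rational
  function free of \<open>a\<close> and \<open>b\<close>, and \<open>kernel_identity\<close>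
  applies. The result is one of the two terms of \<open>gen_schur\<close>.\<close>

lemma gen_schur_kernel_half:
  assumes "x \<noteq> 0" "y \<noteq> 0" "x \<noteq> y"
  shows "q * (q + t ^ 2) * nu_kernel a b x y - t * (1 + q) * nu_kernel (a + 1) (b - 1) x y
      + (q + t ^ 2) * nu_kernel (b - 1) (a + 1) y x - q * t * (1 + q) * nu_kernel (b - 2) (a + 2) y x
    = (q - 1) * (q ^ 2 - t ^ 2) * (1 - t ^ 2) * (x powi (a + 1) * y powi b / (x - y))"
proof -
  \<comment> \<open>These are the lowest powers of \<open>x\<close> and \<open>y\<close> that
    occur.\<close>
  define u v where "u = x powi a" and "v = y powi (b - 2)"
  have pw: "x powi a = u" "x powi (a + 1) = u * x" "y powi (b - 2) = v"
    "y powi (b - 1) = v * y" "y powi b = v * y ^ 2"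
    using assms power_int_add[of x a 1] power_int_add[of y "b - 2" 1] power_int_add[of y "b - 2" 2]
    by (simp_all add: u_def v_def)
  have ix: "a + 1 - 1 = a" "a + 2 - 1 = a + 1" "b - 1 - 1 = b - 2"
    by simp_all
  have neg: "c / (y - x) = - (c / (x - y))" for c
    by (metis minus_diff_eq minus_divide_right)
  have nz: "x - y \<noteq> 0"
    using assms by simp
  have k: "nu_kernel a b x y = u * v * y * ((t * x - y) * (t * y - q * x)) / (x - y)"
    "nu_kernel (a + 1) (b - 1) x y = u * v * x * ((t * x - y) * (t * y - q * x)) / (x - y)"
    "nu_kernel (b - 1) (a + 1) y x = - (u * v * y * ((t * y - x) * (t * x - q * y))) / (x - y)"
    "nu_kernel (b - 2) (a + 2) y x = - (u * v * x * ((t * y - x) * (t * x - q * y))) / (x - y)"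
    unfolding nu_kernel_def neg ix pw by simp_all
  show ?thesis
    \<comment> \<open>Instantiation follows the order of occurrence, where \<open>y\<close> precedes
      \<open>x\<close>; nothing is swapped.\<close>
    unfolding k pw using nz kernel_identity[of q t u v y x]
    by (simp add: divide_simps)
qed

text \<open>Sum of the half identity at \<open>(x, y)\<close> and at \<open>(y, x)\<close>; the
  minus sign in \<open>gen_schur\<close> is absorbed by \<open>y - x\<close>.\<close>

lemma gen_schur_eq_nu_kernel:
  assumes "x \<noteq> 0" "y \<noteq> 0" "x \<noteq> y"
  defines "K \<equiv> \<lambda>a b. nu_kernel a b x y + nu_kernel a b y x"
  shows "q * (q + t ^ 2) * K a b - t * (1 + q) * K (a + 1) (b - 1)
      + (q + t ^ 2) * K (b - 1) (a + 1) - q * t * (1 + q) * K (b - 2) (a + 2)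
    = (q - 1) * (q ^ 2 - t ^ 2) * (1 - t ^ 2) * gen_schur a b x y"
proof -
  have swap: "y powi (a + 1) * x powi b / (y - x) = - (y powi (a + 1) * x powi b / (x - y))"
    by (metis minus_diff_eq minus_divide_right)
  have gen_schur: "gen_schur a b x y =
      x powi (a + 1) * y powi b / (x - y) + y powi (a + 1) * x powi b / (y - x)"
    by (simp add: gen_schur_def diff_divide_distrib swap)
  show ?thesis
    unfolding gen_schur K_def distrib_left[of "(q - 1) * (q ^ 2 - t ^ 2) * (1 - t ^ 2)"]
      gen_schur_kernel_half[OF assms(1,2,3), symmetric]
      gen_schur_kernel_half[OF assms(2,1) assms(3)[symmetric], symmetric]
    by (simp add: algebra_simps)
qed

theorem theorem5p11:
  fixes N :: nat and a b :: int and f :: ratfun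
  assumes "N \<ge> 2" and "f \<in> sym_ratfun N"
  shows "Mac2 N a b f =
    (q * (q + t ^ 2) * nu N a b f
      - t * (1 + q) * nu N (a + 1) (b - 1) f
      + (q + t ^ 2) * nu N (b - 1) (a + 1) f
      - q * t * (1 + q) * nu N (b - 2) (a + 2) f)
    / ((q - 1) * (q ^ 2 - t ^ 2) * (1 - t ^ 2))"
proof -
  let ?S = "{(i, j). 1 \<le> i \<and> i < j \<and> j \<le> N}"
  let ?D = "(q - 1) * (q ^ 2 - t ^ 2) * (1 - t ^ 2)"
  let ?K = "\<lambda>i j a b. nu_kernel a b (X i) (X j) + nu_kernel a b (X j) (X i)"
  let ?R = "\<lambda>i j. pair_prod N i j * shift i (shift j f)"
  have "q * (q + t ^ 2) * nu N a b f - t * (1 + q) * nu N (a + 1) (b - 1) f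
      + (q + t ^ 2) * nu N (b - 1) (a + 1) f - q * t * (1 + q) * nu N (b - 2) (a + 2) f
    = (\<Sum>(i, j)\<in>?S. (q * (q + t ^ 2) * ?K i j a b - t * (1 + q) * ?K i j (a + 1) (b - 1)
      + (q + t ^ 2) * ?K i j (b - 1) (a + 1) - q * t * (1 + q) * ?K i j (b - 2) (a + 2)) * ?R i j)"
    unfolding nu_eq_sum_pairs sum_distrib_left case_prod_unfold
      sum.distrib[symmetric] sum_subtractf[symmetric]
    by (intro sum.cong refl) (simp only: left_diff_distrib distrib_right mult.assoc)
  also have "\<dots> = (\<Sum>(i, j)\<in>?S. ?D * gen_schur a b (X i) (X j) * ?R i j)"
  proof (intro sum.cong refl, clarify)
    fix i j :: nat
    assume "i < j"
    then have "X i \<noteq> X j"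
      by simp
    from gen_schur_eq_nu_kernel[OF X_nonzero X_nonzero this]
    show "(q * (q + t ^ 2) * ?K i j a b - t * (1 + q) * ?K i j (a + 1) (b - 1)
        + (q + t ^ 2) * ?K i j (b - 1) (a + 1) - q * t * (1 + q) * ?K i j (b - 2) (a + 2)) * ?R i j
      = ?D * gen_schur a b (X i) (X j) * ?R i j"
      by (simp only:)
  qed
  also have "\<dots> = ?D * Mac2 N a b f"
    unfolding Mac2_def pair_prod_def[symmetric]
    by (simp only: sum_distrib_left case_prod_unfold mult.assoc)
  finally have "q * (q + t ^ 2) * nu N a b f - t * (1 + q) * nu N (a + 1) (b - 1) f
      + (q + t ^ 2) * nu N (b - 1) (a + 1) f - q * t * (1 + q) * nu N (b - 2) (a + 2) f
    = ?D * Mac2 N a b f" .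
  \<comment> \<open>Division by \<open>0\<close> yields \<open>0\<close> here, so cancelling
    \<open>?D\<close> requires each of its three factors to be nonzero.\<close>
  moreover have "?D \<noteq> 0"
    using q_neq_1 q_power2_neq_t_power2 t_power2_neq_1 by simp
  ultimately show ?thesis
    by (metis nonzero_mult_div_cancel_left)
qed

end
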